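(* Let $W$ be of type $\widehat{SL}_2$ with double affine Weyl semigroup $W_{\mathcal T}$. For all $x,y\in W_{\mathcal T}$, the generalised Demazure product $x*_{u,v}^py=x*y$ is independent of the choice of $(u,v)\in M_{x,y}$ and of the choice of shortest path $p$ from $u$ to $w_yv$ in $\mathrm{QBG}(W)$, where $w_y\in W$ denotes the Weyl component of $y$.
   Context: Type $\widehat{SL}_2$. Let $\alpha$ be the positive root of $SL_2$ with coroot $\alpha^\vee$, $\langle\alpha,\alpha^\vee\rangle=2$. The (real affine) roots are $\Phi=\{\pm\alpha+n\delta: n\in\mathbb Z\}$, the positive roots are $\Phi^+=\{\alpha+n\delta:n\ge 0\}\cup\{-\alpha+n\delta:n\ge 1\}$, and the simple roots are $\tilde\alpha_1=\alpha$, $\tilde\alpha_0=-\alpha+\delta$. The coweight lattice is $P^\vee=\mathbb Z\alpha^\vee\oplus\mathbb Z\delta\oplus\mathbb Z\Lambda_0$, with pairing $\langle \pm\alpha+n\delta,\ k\alpha^\vee+m\delta+l\Lambda_0\rangle=\pm 2k+nl$. The coroot of $\beta=\pm\alpha+n\delta$ is $\beta^\vee=\pm\alpha^\vee+n\delta\in P^\vee$, and the reflection $s_\beta$ acts on $P^\vee$ by $s_\beta(\mu)=\mu-\langle\beta,\mu\rangle\beta^\vee$. The Weyl group is $W=\langle s_0,s_1\mid s_0^2=s_1^2=e\rangle$ (infinite dihedral), $s_i=s_{\tilde\alpha_i}$, with word length $\ell$. Every element of $W$ is uniquely $w_0\tau^{r\alpha^\vee}$ with $w_0\in W_{\mathrm{fin}}=\{e,s_1\}$,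 $r\in\mathbb Z$, where $s_0=s_1\tau^{-\alpha^\vee}$; it acts on $\Phi$ by $w_0\tau^{r\alpha^\vee}(\pm\alpha+n\delta)=\pm w_0\alpha+(n\mp 2r)\delta$. The Tits cone is $\mathcal T=\{k\alpha^\vee+m\delta+l\Lambda_0: k,m\in\mathbb Z,\ l\in\mathbb Z_{>0}\}\cup\mathbb Z\delta$, and $W_{\mathcal T}=W\ltimes\mathcal T$, with elements $w\varepsilon^\mu$ ($w\in W,\mu\in\mathcal T$); $w$ is the Weyl component of $w\varepsilon^\mu$. Quantum Bruhat graph: the directed weighted graph $\mathrm{QBG}(W)$ has vertex set $W$ and an edge $w\to ws_\beta$ ($\beta\in\Phi^+$) if either (Bruhat edge, weight $0$) $\ell(ws_\beta)=\ell(w)+1$, or (quantum edge, weight $\beta^\vee$) $\ell(ws_\beta)=\ell(w)+1-\langle 2\rho,\beta^\vee\rangle$, where $\langle 2\rho,\tilde\alpha_0^\vee\rangle=\langle 2\rho,\tilde\alpha_1^\vee\rangle=2$ (extended linearly). The length of a path is its number of edges, its weight $\mathrm{wt}(p)$ is the sum of the weights of its edges, and $d(u\Rightarrow v)$ is the length of a shortest path from $u$ to $v$. Length positivity: for $\beta\in\Phi$ let $\Phi^+(\beta)=1$ if $\beta\in\Phi^+$ and $0$ otherwise. For $x=w\varepsilon^\mu$ put $\ell(x,\beta)=\langle\beta,\mu\rangle+\Phi^+(\beta)-\Phi^+(w\beta)$, and $\mathrm{LP}(x)=\{v\in W:\ell(x,v\beta)\ge 0\ \text{for all }\beta\in\Phi^+\}$.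 Generalised Demazure product: for $x=w_x\varepsilon^{\mu_x}$, $y=w_y\varepsilon^{\mu_y}$ in $W_{\mathcal T}$, let $M_{x,y}$ be the set of pairs $(u,v)\in\mathrm{LP}(x)\times\mathrm{LP}(y)$ with $d(u\Rightarrow w_yv)\le d(u'\Rightarrow w_yv')$ for all $(u',v')\in\mathrm{LP}(x)\times\mathrm{LP}(y)$. For $(u,v)\in M_{x,y}$ and a shortest path $p$ from $u$ to $w_yv$ in $\mathrm{QBG}(W)$, set $x*_{u,v}^p y=w_xuv^{-1}\varepsilon^{vu^{-1}\mu_x+\mu_y-v\,\mathrm{wt}(p)}$. *)

theory Defs
  imports
    "HOL-Library.Product_Plus"
    "HOL-Library.Extended_Nat"
    "Graph_Theory.Arc_Walk"
begin

section \<open>Roots and coweights\<close>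

text \<open>The triple \<open>(k, m, l)\<close> stands for the coweight \<open>k \<alpha>\<^sup>\<or> + m \<delta> + l \<Lambda>\<^sub>0\<close>, and the pair \<open>(a, n)\<close>
  with \<open>a = 1\<close> or \<open>a = -1\<close> for the real affine root \<open>a \<alpha> + n \<delta>\<close>.\<close>

type_synonym coweight = "int \<times> int \<times> int"
type_synonym root = "int \<times> int"

definition roots :: "root set" where
  "roots = {1, -1} \<times> UNIV"

definition pos_roots :: "root set" where
  "pos_roots = {(1, n) |n. n \<ge> 0} \<union> {(-1, n) |n. n \<ge> 1}"

definition simple_root1 :: root where
  "simple_root1 = (1, 0)"

definition simple_root0 :: root where
  "simple_root0 = (-1, 1)"

fun pairing :: "root \<Rightarrow> coweight \<Rightarrow> int" where
  "pairing (a, n) (k, m, l) = 2 * a * k + n * l"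

fun coroot :: "root \<Rightarrow> coweight" where
  "coroot (a, n) = (a, n, 0)"

fun cw_scale :: "int \<Rightarrow> coweight \<Rightarrow> coweight" where
  "cw_scale c (k, m, l) = (c * k, c * m, c * l)"

definition reflection :: "root \<Rightarrow> coweight \<Rightarrow> coweight" where
  "reflection \<beta> \<mu> = \<mu> - cw_scale (pairing \<beta> \<mu>) (coroot \<beta>)"

text \<open>The linear extension of \<open>\<langle>2\<rho>, \<cdot>\<rangle>\<close> from the two simple coroots to their span
  \<open>\<int>\<alpha>\<^sup>\<or> + \<int>\<delta>\<close>; see \<open>two_rho_simple\<close> below. It is only applied to coroots, so its value on
  \<open>\<Lambda>\<^sub>0\<close> (here 0) plays no role.\<close>

fun two_rho :: "coweight \<Rightarrow> int" where
  "two_rho (k, m, l) = 2 * k + 4 * m"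

lemma two_rho_simple:
  "two_rho (coroot simple_root0) = 2" "two_rho (coroot simple_root1) = 2"
  by (simp_all add: simple_root0_def simple_root1_def)

lemma two_rho_linear:
  "two_rho (\<mu> + \<nu>) = two_rho \<mu> + two_rho \<nu>" "two_rho (cw_scale c \<mu>) = c * two_rho \<mu>"
  by (cases \<mu>; cases \<nu>; simp add: algebra_simps)+


section \<open>The affine Weyl group\<close>

text \<open>The Weyl group is realised by its faithful action on the coweight lattice. Group
  multiplication is composition and inversion is \<open>inv\<close>; since \<open>s\<^sub>0\<close> and \<open>s\<^sub>1\<close> are involutions,
  the subgroup they generate consists of the products of words in them.\<close>

definition s0 :: "coweight \<Rightarrow> coweight" where
  "s0 = reflection simple_root0"

definition s1 :: "coweight \<Rightarrow> coweight" where
  "s1 = reflection simple_root1"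

definition word_prod :: "(coweight \<Rightarrow> coweight) list \<Rightarrow> coweight \<Rightarrow> coweight" where
  "word_prod ws = foldr (\<circ>) ws id"

definition weyl :: "(coweight \<Rightarrow> coweight) set" where
  "weyl = {word_prod ws |ws. set ws \<subseteq> {s0, s1}}"

definition weyl_length :: "(coweight \<Rightarrow> coweight) \<Rightarrow> nat" where
  "weyl_length w = (LEAST n. \<exists>ws. set ws \<subseteq> {s0, s1} \<and> word_prod ws = w \<and> length ws = n)"

text \<open>The action on roots is transported along the bijection between roots and coroots, i.e.
  \<open>(w \<beta>)\<^sup>\<or> = w \<beta>\<^sup>\<or>\<close>. The lemma \<open>root_act_normal_form\<close> below gives the explicit formula.\<close>

definition root_act :: "(coweight \<Rightarrow> coweight) \<Rightarrow> root \<Rightarrow> root" where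
  "root_act w \<beta> = the_inv_into roots coroot (w (coroot \<beta>))"

lemma s0_apply: "s0 (k, m, l) = (l - k, m - l + 2 * k, l)"
  by (simp add: s0_def reflection_def simple_root0_def)

lemma s1_apply: "s1 (k, m, l) = (- k, m, l)"
  by (simp add: s1_def reflection_def simple_root1_def)

text \<open>The translation \<open>\<tau>\<close> to the power \<open>r \<alpha>\<^sup>\<or>\<close>; it is not used in the definitions below, only to
  relate them to the presentation of the Weyl group as an infinite dihedral group.\<close>

fun transl :: "int \<Rightarrow> coweight \<Rightarrow> coweight" where
  "transl r (k, m, l) = (k + r * l, m - 2 * r * k - r * r * l, l)"

lemma transl_rules:
  "transl 0 = id" "transl r \<circ> transl t = transl (r + t)" "transl r \<circ> s1 = s1 \<circ> transl (- r)"
  "s1 \<circ> s1 = id" "s0 \<circ> s0 = id" "s0 = s1 \<circ> transl (- 1)" "inj transl"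
proof -
  show "inj transl"
  proof (rule injI)
    fix r t assume "transl r = transl t"
    then have "transl r (0, 0, 1) = transl t (0, 0, 1)" by simp
    then show "r = t" by simp
  qed
qed (auto simp: fun_eq_iff s0_apply s1_apply algebra_simps)

lemma weyl_normal_form: "weyl = range transl \<union> range (\<lambda>r. s1 \<circ> transl r)"
proof
  have "word_prod ws \<in> range transl \<union> range (\<lambda>r. s1 \<circ> transl r)" if "set ws \<subseteq> {s0, s1}" for ws
    using that
  proof (induction ws)
    case Nil
    have "word_prod [] = transl 0" by (simp add: word_prod_def transl_rules(1))
    then show ?case by (metis UnI1 rangeI)
  next
    case (Cons s ws)
    then have "word_prod ws \<in> range transl \<union> range (\<lambda>r. s1 \<circ> transl r)"
      by (metis insert_subset list.simps(15))
    then obtain r where r: "word_prod ws = transl r \<or> word_prod ws = s1 \<circ> transl r" by blast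
    have e: "word_prod (s # ws) = s \<circ> word_prod ws" by (simp add: word_prod_def)
    have c: "s1 \<circ> (s1 \<circ> transl r) = transl r" "s0 \<circ> transl r = s1 \<circ> transl (r - 1)"
      "s0 \<circ> (s1 \<circ> transl r) = transl (r + 1)"
      by (auto simp: fun_eq_iff s0_apply s1_apply algebra_simps)
    from Cons.prems consider "s = s0" | "s = s1" by fastforce
    then have "\<exists>t. s \<circ> word_prod ws = transl t \<or> s \<circ> word_prod ws = s1 \<circ> transl t"
      using r c by cases metis+
    then show ?case unfolding e by blast
  qed
  then show "weyl \<subseteq> range transl \<union> range (\<lambda>r. s1 \<circ> transl r)" unfolding weyl_def by blast
next
  have e: "word_prod (s # ws) = s \<circ> word_prod ws" for s ws by (simp add: word_prod_def)
  have step: "s \<circ> w \<in> weyl" if "w \<in> weyl" "s \<in> {s0, s1}" for s w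
  proof -
    obtain ws where "w = word_prod ws" "set ws \<subseteq> {s0, s1}" using \<open>w \<in> weyl\<close> by (auto simp: weyl_def)
    then have "s \<circ> w = word_prod (s # ws)" "set (s # ws) \<subseteq> {s0, s1}" using that(2) e by auto
    then show ?thesis unfolding weyl_def by blast
  qed
  have "word_prod [] = id" by (simp add: word_prod_def)
  then have z: "transl 0 \<in> weyl" unfolding transl_rules(1) weyl_def
    by (intro CollectI exI[of _ "[]"]) simp
  have t: "transl r \<in> weyl" for r
  proof (induction r rule: int_induct[where k = 0])
    case base show ?case by (rule z)
  next
    case (step1 r)
    have "transl (r + 1) = s0 \<circ> (s1 \<circ> transl r)"
      by (auto simp: fun_eq_iff s0_apply s1_apply algebra_simps)
    then show ?case using step step1(2) by (metis insertCI)
  next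
    case (step2 r)
    have "transl (r - 1) = s1 \<circ> (s0 \<circ> transl r)"
      by (auto simp: fun_eq_iff s0_apply s1_apply algebra_simps)
    then show ?case using step step2(2) by (metis insertCI)
  qed
  then show "range transl \<union> range (\<lambda>r. s1 \<circ> transl r) \<subseteq> weyl" using step by blast
qed

lemma root_act_normal_form:
  assumes "(a, n) \<in> roots"
  shows "root_act (transl r) (a, n) = (a, n - 2 * a * r)"
    and "root_act (s1 \<circ> transl r) (a, n) = (- a, n - 2 * a * r)"
proof -
  have inj: "inj_on coroot roots" by (auto simp: inj_on_def)
  have c: "the_inv_into roots coroot (b, j, 0) = (b, j)" if "(b, j) \<in> roots" for b j
    using the_inv_into_f_f[OF inj that] by simp
  have m: "(a, j) \<in> roots" "(- a, j) \<in> roots" for j using assms by (auto simp: roots_def)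
  show "root_act (transl r) (a, n) = (a, n - 2 * a * r)"
    using c[OF m(1)] by (simp add: root_act_def algebra_simps)
  show "root_act (s1 \<circ> transl r) (a, n) = (- a, n - 2 * a * r)"
    using c[OF m(2)] by (simp add: root_act_def s1_apply algebra_simps)
qed


section \<open>The double affine Weyl semigroup\<close>

definition tits_cone :: "coweight set" where
  "tits_cone = {(k, m, l) |k m l. l > 0} \<union> {(0, m, 0) |m. True}"

text \<open>The pair \<open>(w, \<mu>)\<close> stands for \<open>w \<epsilon>\<^sup>\<mu>\<close>.\<close>

type_synonym daw = "(coweight \<Rightarrow> coweight) \<times> coweight"

definition daw_semigroup :: "daw set" where
  "daw_semigroup = weyl \<times> tits_cone"


section \<open>The quantum Bruhat graph\<close>

text \<open>An arc is a triple (source, weight, target).\<close>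

type_synonym qbg_arc = "(coweight \<Rightarrow> coweight) \<times> coweight \<times> (coweight \<Rightarrow> coweight)"

definition bruhat_arcs :: "qbg_arc set" where
  "bruhat_arcs = {(w, 0, w \<circ> reflection \<beta>) |w \<beta>. w \<in> weyl \<and> \<beta> \<in> pos_roots \<and>
     weyl_length (w \<circ> reflection \<beta>) = weyl_length w + 1}"

definition quantum_arcs :: "qbg_arc set" where
  "quantum_arcs = {(w, coroot \<beta>, w \<circ> reflection \<beta>) |w \<beta>. w \<in> weyl \<and> \<beta> \<in> pos_roots \<and>
     int (weyl_length (w \<circ> reflection \<beta>)) = int (weyl_length w) + 1 - two_rho (coroot \<beta>)}"

definition QBG :: "(coweight \<Rightarrow> coweight, qbg_arc) pre_digraph" where
  "QBG = \<lparr>verts = weyl, arcs = bruhat_arcs \<union> quantum_arcs,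
          tail = \<lambda>(w, \<eta>, w'). w, head = \<lambda>(w, \<eta>, w'). w'\<rparr>"

abbreviation qbg_path ::
  "(coweight \<Rightarrow> coweight) \<Rightarrow> qbg_arc list \<Rightarrow> (coweight \<Rightarrow> coweight) \<Rightarrow> bool" where
  "qbg_path \<equiv> pre_digraph.awalk QBG"

definition path_weight :: "qbg_arc list \<Rightarrow> coweight" where
  "path_weight p = (\<Sum>(w, \<eta>, w')\<leftarrow>p. \<eta>)"

text \<open>The distance is infinite if there is no path.\<close>

definition qbg_dist :: "(coweight \<Rightarrow> coweight) \<Rightarrow> (coweight \<Rightarrow> coweight) \<Rightarrow> enat" where
  "qbg_dist u v = (INF p\<in>{p. qbg_path u p v}. enat (length p))"

definition shortest_qbg_path ::
  "(coweight \<Rightarrow> coweight) \<Rightarrow> qbg_arc list \<Rightarrow> (coweight \<Rightarrow> coweight) \<Rightarrow> bool" where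
  "shortest_qbg_path u p v \<longleftrightarrow> qbg_path u p v \<and> enat (length p) = qbg_dist u v"


section \<open>Length positivity and the generalised Demazure product\<close>

definition pos_ind :: "root \<Rightarrow> int" where
  "pos_ind \<beta> = (if \<beta> \<in> pos_roots then 1 else 0)"

fun length_fun :: "daw \<Rightarrow> root \<Rightarrow> int" where
  "length_fun (w, \<mu>) \<beta> = pairing \<beta> \<mu> + pos_ind \<beta> - pos_ind (root_act w \<beta>)"

definition LP :: "daw \<Rightarrow> (coweight \<Rightarrow> coweight) set" where
  "LP x = {v \<in> weyl. \<forall>\<beta>\<in>pos_roots. length_fun x (root_act v \<beta>) \<ge> 0}"

definition min_pairs :: "daw \<Rightarrow> daw \<Rightarrow> ((coweight \<Rightarrow> coweight) \<times> (coweight \<Rightarrow> coweight)) set" where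
  "min_pairs x y = {(u, v) \<in> LP x \<times> LP y. \<forall>(u', v') \<in> LP x \<times> LP y.
     qbg_dist u (fst y \<circ> v) \<le> qbg_dist u' (fst y \<circ> v')}"

fun demazure_prod ::
  "daw \<Rightarrow> daw \<Rightarrow> (coweight \<Rightarrow> coweight) \<Rightarrow> (coweight \<Rightarrow> coweight) \<Rightarrow> qbg_arc list \<Rightarrow> daw" where
  "demazure_prod (wx, \<mu>x) (wy, \<mu>y) u v p =
     (wx \<circ> u \<circ> inv v, v (inv u \<mu>x) + \<mu>y - v (path_weight p))"

end

theory Submission
  imports Defs
begin

text \<open>The Weyl group is infinite dihedral, so its elements correspond to integers \<open>a\<close>, with
  length \<open>\<bar>a\<bar>\<close>. In the quantum Bruhat graph an element has upward edges of weight 0 to both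
  elements of the next length, and one quantum edge, towards 0. Hence distances are explicit,
  shortest paths use at most one upward edge after a quantum edge, and the place where this edge
  is inserted does not affect the weight.

  In these coordinates \<open>LP x\<close> and \<open>w\<^sub>y LP y\<close> become intervals \<open>I\<close> and \<open>J\<close>. The first one contains
  \<open>-1\<close> and \<open>1\<close> only if it is everything, the second one is everything if it contains \<open>0\<close> together
  with \<open>2\<close> or \<open>-2\<close>. Therefore two distinct minimising pairs can occur only at distance 0 or
  for single upward edges that all go from \<open>a\<close> to \<open>1 - a\<close>, or all to \<open>-1 - a\<close>. In both cases all
  weights vanish, and \<open>u = g w\<^sub>y v\<close> for a common \<open>g \<in> {e, s\<^sub>0, s\<^sub>1}\<close>, so \<open>u v\<^sup>-\<^sup>1\<close> and the whole product do not depend on the pair.\<close>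

section \<open>The Weyl group as the integers\<close>

text \<open>The element with number \<open>a\<close> maps the positive roots to
  \<open>{\<alpha> + n\<delta> | n \<ge> a} \<union> {-\<alpha> + n\<delta> | n > -a}\<close>.\<close>

definition weyl_elt :: "int \<Rightarrow> coweight \<Rightarrow> coweight" where
  "weyl_elt a = (if even a then transl (- (a div 2)) else s1 \<circ> transl (a div 2))"

lemma weyl_elt_even: "weyl_elt (2 * r) = transl (- r)"
  by (simp add: weyl_elt_def)

lemma weyl_elt_odd: "weyl_elt (2 * r + 1) = s1 \<circ> transl r"
  by (simp add: weyl_elt_def)

lemma weyl_eq_range: "weyl = range weyl_elt"
proof
  show "weyl \<subseteq> range weyl_elt"
  proof
    fix w assume "w \<in> weyl"
    then consider r where "w = transl r" | r where "w = s1 \<circ> transl r"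
      unfolding weyl_normal_form by blast
    then show "w \<in> range weyl_elt"
    proof cases
      case 1
      then have "w = weyl_elt (2 * (- r))" by (simp only: weyl_elt_even minus_minus)
      then show ?thesis by blast
    next
      case 2
      then show ?thesis using weyl_elt_odd by (metis rangeI)
    qed
  qed
  show "range weyl_elt \<subseteq> weyl"
    unfolding weyl_normal_form weyl_elt_def by auto
qed

lemma weyl_elt_mult:
  "weyl_elt a \<circ> weyl_elt b = weyl_elt (if even a then a + b else a - b)"
proof -
  have m: "weyl_elt (2 * r) \<circ> weyl_elt (2 * t) = weyl_elt (2 * (r + t))"
    "weyl_elt (2 * r) \<circ> weyl_elt (2 * t + 1) = weyl_elt (2 * (r + t) + 1)"
    "weyl_elt (2 * r + 1) \<circ> weyl_elt (2 * t) = weyl_elt (2 * (r - t) + 1)"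
    "weyl_elt (2 * r + 1) \<circ> weyl_elt (2 * t + 1) = weyl_elt (2 * (r - t))" for r t
    unfolding weyl_elt_even weyl_elt_odd by (auto simp: fun_eq_iff s1_apply algebra_simps)
  obtain r where "a = 2 * r \<or> a = 2 * r + 1" by (metis evenE oddE)
  moreover obtain t where "b = 2 * t \<or> b = 2 * t + 1" by (metis evenE oddE)
  ultimately consider "a = 2 * r" "b = 2 * t" | "a = 2 * r" "b = 2 * t + 1"
    | "a = 2 * r + 1" "b = 2 * t" | "a = 2 * r + 1" "b = 2 * t + 1" by blast
  then show ?thesis
  proof cases
    case 1
    then have "(if even a then a + b else a - b) = 2 * (r + t)" by simp
    then show ?thesis unfolding 1 m by (simp only:)
  next
    case 2
    then have "(if even a then a + b else a - b) = 2 * (r + t) + 1" by simp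
    then show ?thesis unfolding 2 m by (simp only:)
  next
    case 3
    then have "(if even a then a + b else a - b) = 2 * (r - t) + 1" by simp
    then show ?thesis unfolding 3 m by (simp only:)
  next
    case 4
    then have "(if even a then a + b else a - b) = 2 * (r - t)" by simp
    then show ?thesis unfolding 4 m by (simp only:)
  qed
qed

lemma weyl_elt_simple:
  "weyl_elt 0 = id" "weyl_elt 1 = s1" "weyl_elt (- 1) = s0"
  by (auto simp: weyl_elt_def fun_eq_iff s0_apply s1_apply)

lemma inj_weyl_elt: "weyl_elt a = weyl_elt b \<longleftrightarrow> a = b"
proof
  assume h: "weyl_elt a = weyl_elt b"
  obtain r where r: "a = 2 * r \<or> a = 2 * r + 1" by (metis evenE oddE)
  obtain t where t: "b = 2 * t \<or> b = 2 * t + 1" by (metis evenE oddE)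
  have "weyl_elt a (0, 0, 1) = weyl_elt b (0, 0, 1)" "weyl_elt a (1, 0, 0) = weyl_elt b (1, 0, 0)"
    using h by simp_all
  then show "a = b" using r t by (auto simp: weyl_elt_even weyl_elt_odd s1_apply)
qed simp

lemma bij_weyl_elt: "bij (weyl_elt a)"
proof -
  \<comment> \<open>Even numbers are translations, inverted by negation; odd ones are reflections,
    hence involutions.\<close>
  have "weyl_elt (if even a then - a else a) \<circ> weyl_elt a = id"
    "weyl_elt a \<circ> weyl_elt (if even a then - a else a) = id"
    by (auto simp: weyl_elt_mult weyl_elt_simple)
  then show ?thesis by (rule o_bij)
qed

lemma weyl_elt_zero: "weyl_elt a 0 = 0"
proof -
  have z: "(0 :: coweight) = (0, 0, 0)" by (simp add: zero_prod_def)
  show ?thesis unfolding z by (simp add: weyl_elt_def s1_apply)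
qed

text \<open>Left multiplication by \<open>s1\<close> or \<open>s0\<close> sends \<open>b\<close> to
  \<open>1 - b\<close> or \<open>- 1 - b\<close>, so each letter changes the absolute value by one,
  and for nonzero \<open>b\<close> one of the two lowers it.\<close>

lemma weyl_length_elt: "weyl_length (weyl_elt a) = nat \<bar>a\<bar>"
proof -
  have lower: "\<exists>b. word_prod ws = weyl_elt b \<and> \<bar>b\<bar> \<le> int (length ws)"
    if "set ws \<subseteq> {s0, s1}" for ws
    using that
  proof (induction ws)
    case Nil
    then show ?case
      by (intro exI[of _ 0]) (simp add: word_prod_def weyl_elt_simple)
  next
    case (Cons s ws)
    then obtain b where b: "word_prod ws = weyl_elt b" "\<bar>b\<bar> \<le> int (length ws)" by auto
    have "s = weyl_elt (- 1) \<or> s = weyl_elt 1" using Cons.prems by (simp add: weyl_elt_simple)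
    moreover have "word_prod (s # ws) = s \<circ> weyl_elt b" using b by (simp add: word_prod_def)
    ultimately have "word_prod (s # ws) = weyl_elt (- 1 - b) \<or> word_prod (s # ws) = weyl_elt (1 - b)"
      by (auto simp: weyl_elt_mult)
    moreover have "\<bar>- 1 - b\<bar> \<le> int (length (s # ws))" "\<bar>1 - b\<bar> \<le> int (length (s # ws))"
      using b(2) by auto
    ultimately show ?case by blast
  qed
  have upper: "\<exists>ws. set ws \<subseteq> {s0, s1} \<and> word_prod ws = weyl_elt b \<and> length ws = n"
    if "\<bar>b\<bar> = int n" for b n
    using that
  proof (induction n arbitrary: b)
    case 0
    then show ?case by (intro exI[of _ "[]"]) (simp add: word_prod_def weyl_elt_simple)
  next
    case (Suc n)
    define c where "c = (if b > 0 then 1 - b else - 1 - b)"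
    have "\<bar>c\<bar> = int n" using Suc.prems by (auto simp: c_def)
    then obtain ws where ws: "set ws \<subseteq> {s0, s1}" "word_prod ws = weyl_elt c" "length ws = n"
      using Suc.IH by blast
    define s where "s = weyl_elt (if b > 0 then 1 else - 1)"
    have "word_prod (s # ws) = weyl_elt b"
      using ws(2) by (auto simp: word_prod_def s_def c_def weyl_elt_mult)
    moreover have "s \<in> {s0, s1}" by (simp add: s_def weyl_elt_simple)
    ultimately show ?case using ws by (intro exI[of _ "s # ws"]) auto
  qed
  show ?thesis unfolding weyl_length_def
  proof (rule Least_equality)
    show "\<exists>ws. set ws \<subseteq> {s0, s1} \<and> word_prod ws = weyl_elt a \<and> length ws = nat \<bar>a\<bar>"
      using upper by simp
  next
    fix n assume "\<exists>ws. set ws \<subseteq> {s0, s1} \<and> word_prod ws = weyl_elt a \<and> length ws = n"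
    then show "nat \<bar>a\<bar> \<le> n" using lower inj_weyl_elt by fastforce
  qed
qed

text \<open>Reflections in positive roots thus run through the odd numbers: \<alpha> + n\<delta>
  yields the positive ones, -\<alpha> + n\<delta> the negative ones.\<close>

lemma reflection_eq_elt:
  "reflection (1, n) = weyl_elt (2 * n + 1)" "reflection (- 1, n) = weyl_elt (1 - 2 * n)"
proof -
  show "reflection (1, n) = weyl_elt (2 * n + 1)"
    unfolding weyl_elt_odd by (auto simp: fun_eq_iff reflection_def s1_apply algebra_simps)
  have "1 - 2 * n = 2 * (- n) + 1" by simp
  then have "weyl_elt (1 - 2 * n) = s1 \<circ> transl (- n)" by (simp only: weyl_elt_odd)
  then show "reflection (- 1, n) = weyl_elt (1 - 2 * n)"
    by (auto simp: fun_eq_iff reflection_def s1_apply algebra_simps)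
qed


section \<open>Distances and weights in the quantum Bruhat graph\<close>

text \<open>The weight of the path of quantum edges from \<open>weyl_elt a\<close> to the identity.\<close>

definition down_weight :: "int \<Rightarrow> coweight" where
  "down_weight a = (if even a then (0, \<bar>a\<bar> div 2, 0) else (sgn a, (\<bar>a\<bar> - sgn a) div 2, 0))"

text \<open>The arcs in integer coordinates, see \<open>arcs_QBG\<close>. The quantum weight is a
  difference so that weights telescope along a descent.\<close>

definition step :: "int \<Rightarrow> coweight \<Rightarrow> int \<Rightarrow> bool" where
  "step a \<eta> b \<longleftrightarrow> \<eta> = 0 \<and> \<bar>b\<bar> = \<bar>a\<bar> + 1 \<or>
     a \<noteq> 0 \<and> b = a - sgn a \<and> \<eta> = down_weight a - down_weight b"

lemma step_cases:
  assumes "step a \<eta> b"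
  shows "b = a - 1 \<and> a > 0 \<or> b = a + 1 \<and> a < 0 \<or> \<bar>b\<bar> = \<bar>a\<bar> + 1"
  using assms unfolding step_def by (auto simp: sgn_if split: if_splits)

text \<open>A quantum arc removes the last letter of the reduced word; parity and sign of
  \<open>a\<close> decide whether it is \<open>s1\<close> or \<open>s0\<close>, and the weight is
  its simple coroot.\<close>

lemma down_weight_diff:
  "a \<noteq> 0 \<Longrightarrow> down_weight a - down_weight (a - sgn a) =
     (if even a \<longleftrightarrow> a < 0 then (1, 0, 0) else (- 1, 1, 0))"
  by (cases "even a"; cases "a > 0"; auto simp: down_weight_def sgn_if zero_prod_def; presburger)

text \<open>\<open>down_weight n\<close> sums the simple coroots of the letters of the reduced word.
  The first letter is \<open>s1\<close> here and \<open>s0\<close> in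
  \<open>down_weight_neg\<close>; deleting it leaves a word on the other side of 0.\<close>

lemma down_weight_pos: "n > 0 \<Longrightarrow> down_weight n = down_weight (1 - n) + (1, 0, 0)"
  by (cases "even n"; cases "n = 1"; auto simp: down_weight_def sgn_if zero_prod_def; presburger)

lemma down_weight_neg: "n < 0 \<Longrightarrow> down_weight n = down_weight (- 1 - n) + (- 1, 1, 0)"
  by (cases "even n"; cases "n = -1"; auto simp: down_weight_def sgn_if zero_prod_def; presburger)

text \<open>Elements whose numbers differ in parity differ by a reflection, so any two consecutive
  lengths give a Bruhat arc, whereas the length condition on quantum arcs leaves only simple
  roots.\<close>

lemma arcs_QBG:
  "arcs QBG = {(weyl_elt a, \<eta>, weyl_elt b) |a \<eta> b. step a \<eta> b}" (is "_ = ?S")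
proof
  have mult: "weyl_elt a \<circ> reflection \<beta> =
      weyl_elt (if even a then a + (2 * n * e + 1) else a - (2 * n * e + 1))"
    if "\<beta> = (e, n)" "e = 1 \<or> e = - 1" for a \<beta> e n
    using that by (auto simp: reflection_eq_elt weyl_elt_mult)
  show "arcs QBG \<subseteq> ?S"
  proof
    fix z assume "z \<in> arcs QBG"
    then have "z \<in> bruhat_arcs \<or> z \<in> quantum_arcs" by (simp add: QBG_def)
    then have "\<exists>w \<beta> \<eta>. z = (w, \<eta>, w \<circ> reflection \<beta>) \<and> w \<in> weyl \<and> \<beta> \<in> pos_roots \<and>
        (\<eta> = 0 \<and> weyl_length (w \<circ> reflection \<beta>) = weyl_length w + 1 \<or>
         \<eta> = coroot \<beta> \<and> int (weyl_length (w \<circ> reflection \<beta>)) =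
           int (weyl_length w) + 1 - two_rho (coroot \<beta>))"
      unfolding bruhat_arcs_def quantum_arcs_def by blast
    then obtain w \<beta> \<eta> where z: "z = (w, \<eta>, w \<circ> reflection \<beta>)" "\<beta> \<in> pos_roots" and w: "w \<in> weyl"
      and c: "\<eta> = 0 \<and> weyl_length (w \<circ> reflection \<beta>) = weyl_length w + 1 \<or>
        \<eta> = coroot \<beta> \<and> int (weyl_length (w \<circ> reflection \<beta>)) =
          int (weyl_length w) + 1 - two_rho (coroot \<beta>)"
      by blast
    obtain a where a: "w = weyl_elt a" using w unfolding weyl_eq_range by blast
    obtain e n where en: "\<beta> = (e, n)" "e = 1 \<and> n \<ge> 0 \<or> e = - 1 \<and> n \<ge> 1"
      using z(2) by (auto simp: pos_roots_def)
    define b where "b = (if even a then a + (2 * n * e + 1) else a - (2 * n * e + 1))"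
    have b: "w \<circ> reflection \<beta> = weyl_elt b"
      unfolding a b_def by (rule mult[OF en(1)]) (use en(2) in auto)
    have "step a \<eta> b"
    proof (cases "\<eta> = 0 \<and> \<bar>b\<bar> = \<bar>a\<bar> + 1")
      case False
      then have q: "\<eta> = (e, n, 0)" "\<bar>b\<bar> = \<bar>a\<bar> + 1 - (2 * e + 4 * n)"
        using c False unfolding b unfolding a weyl_length_elt by (auto simp: en(1))
      \<comment> \<open>The reflection has length \<open>2 * n + e\<close>, yet the length must drop
        by \<open>4 * n + 2 * e - 1\<close>; this forces \<open>2 * n + e = 1\<close>.\<close>
      have "e = 1 \<and> n = 0 \<or> e = - 1 \<and> n = 1" using en(2) q(2)
        by (auto simp: b_def split: if_splits)
      then have "a \<noteq> 0 \<and> b = a - sgn a \<and>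
          \<eta> = (if even a \<longleftrightarrow> a < 0 then (1, 0, 0) else (- 1, 1, 0))"
        using q by (auto simp: b_def sgn_if split: if_splits)
      then show ?thesis unfolding step_def using down_weight_diff by metis
    qed (simp add: step_def)
    then show "z \<in> ?S" unfolding z(1) b unfolding a by blast
  qed
  show "?S \<subseteq> arcs QBG"
  proof
    fix z assume "z \<in> ?S"
    then obtain a \<eta> b where z: "z = (weyl_elt a, \<eta>, weyl_elt b)" "step a \<eta> b" by blast
    have w: "weyl_elt a \<in> weyl" using weyl_eq_range by blast
    define c where "c = (if even a then b - a else a - b)"
    have "odd (a + b)" using step_cases[OF z(2)] by presburger
    then have "odd c" by (auto simp: c_def)
    \<comment> \<open>The positive root whose reflection has number \<open>c\<close>; as
      \<open>div\<close> rounds down, negative \<open>c\<close> gives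
      \<open>- (c div 2) \<ge> 1\<close>.\<close>
    define \<beta> :: root where "\<beta> = (if c > 0 then (1, c div 2) else (- 1, - (c div 2)))"
    have \<beta>: "\<beta> \<in> pos_roots" using \<open>odd c\<close> by (auto simp: \<beta>_def pos_roots_def elim!: oddE)
    have r: "reflection \<beta> = weyl_elt c"
      using \<open>odd c\<close> by (auto simp: \<beta>_def reflection_eq_elt add.commute elim!: oddE)
    have b: "weyl_elt b = weyl_elt a \<circ> reflection \<beta>" unfolding r by (auto simp: weyl_elt_mult c_def)
    from z(2) show "z \<in> arcs QBG" unfolding step_def
    proof (elim disjE conjE)
      assume "\<eta> = 0" "\<bar>b\<bar> = \<bar>a\<bar> + 1"
      then have "weyl_length (weyl_elt a \<circ> reflection \<beta>) = weyl_length (weyl_elt a) + 1"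
        unfolding b[symmetric] weyl_length_elt by simp
      then have "z \<in> bruhat_arcs" unfolding bruhat_arcs_def z(1) b \<open>\<eta> = 0\<close> using w \<beta> by blast
      then show ?thesis by (simp add: QBG_def)
    next
      assume q: "a \<noteq> 0" "b = a - sgn a" "\<eta> = down_weight a - down_weight b"
      have \<eta>: "\<eta> = coroot \<beta>" and "two_rho (coroot \<beta>) = 2"
        using q down_weight_diff[OF q(1)] by (auto simp: \<beta>_def c_def sgn_if)
      moreover have "int (weyl_length (weyl_elt b)) = int (weyl_length (weyl_elt a)) + 1 - 2"
        using q by (auto simp: weyl_length_elt sgn_if)
      ultimately have "int (weyl_length (weyl_elt a \<circ> reflection \<beta>)) =
          int (weyl_length (weyl_elt a)) + 1 - two_rho (coroot \<beta>)"
        unfolding b by simp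
      then have "z \<in> quantum_arcs" unfolding quantum_arcs_def z(1) b \<eta> using w \<beta> by blast
      then show ?thesis by (simp add: QBG_def)
    qed
  qed
qed

text \<open>Closed form of the distance. A longer element is reached by upward arcs alone; otherwise
  one descends, and the 2 pays for one upward arc changing the side of 0 and the descent that makes
  up for it.\<close>

definition zdist :: "int \<Rightarrow> int \<Rightarrow> int" where
  "zdist a c = (if \<bar>a\<bar> < \<bar>c\<bar> then \<bar>c\<bar> - \<bar>a\<bar>
     else if a < 0 \<and> 0 < c \<or> 0 < a \<and> c < 0 then \<bar>a\<bar> - \<bar>c\<bar> + 2 else \<bar>a\<bar> - \<bar>c\<bar>)"

text \<open>Weight of a shortest path. If the side changes, the model path descends to
  \<open>sgn c - c\<close>, one shorter than \<open>c\<close> on the side of \<open>a\<close>, and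
  then rises to \<open>c\<close> with weight 0.\<close>

definition zweight :: "int \<Rightarrow> int \<Rightarrow> coweight" where
  "zweight a c = (if \<bar>a\<bar> < \<bar>c\<bar> then 0
     else if a < 0 \<and> 0 < c \<or> 0 < a \<and> c < 0 then down_weight a - down_weight (sgn c - c)
     else down_weight a - down_weight c)"

lemma zweight_self: "zweight a a = 0"
  by (auto simp: zweight_def)

lemma zweight_up: "\<bar>a\<bar> < \<bar>c\<bar> \<Longrightarrow> zweight a c = 0"
  by (simp add: zweight_def)

lemma zdist_le_0: "zdist a c \<le> 0 \<longleftrightarrow> a = c"
  by (auto simp: zdist_def)

lemma zdist_step:
  assumes "step a \<eta> b"
  shows "zdist a c \<le> 1 + zdist b c"
  using step_cases[OF assms] unfolding zdist_def by (elim disjE) (auto split: if_splits)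

text \<open>In a descent with a change of side, the only freedom is where the upward arc sits.
  Moving it is harmless: by \<open>down_weight_pos\<close> and \<open>down_weight_neg\<close> both
  ends of the descent shift by the same simple coroot.\<close>

lemma zweight_step:
  assumes "step a \<eta> b" "zdist a c = 1 + zdist b c"
  shows "zweight a c = \<eta> + zweight b c"
  using assms(1) unfolding step_def
proof (elim disjE conjE)
  assume up: "\<eta> = 0" "\<bar>b\<bar> = \<bar>a\<bar> + 1"
  \<comment> \<open>An upward arc on a shortest path either approaches a longer \<open>c\<close> or
    crosses to the side of \<open>c\<close>.\<close>
  consider "\<bar>a\<bar> < \<bar>c\<bar>" | "a < 0" "0 < c" "c \<le> - a" "b = 1 - a" | "a > 0" "c < 0" "- c \<le> a" "b = - 1 - a"
    using up(2) assms(2) unfolding zdist_def by (auto split: if_splits)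
  then show ?thesis
  proof cases
    case 1
    then have "\<bar>b\<bar> < \<bar>c\<bar> \<or> b = c" using up assms(2) by (auto simp: zdist_def split: if_splits)
    then show ?thesis using 1 up(1) by (auto simp: zweight_def)
  next
    case 2
    then show ?thesis using up(1) down_weight_pos[of b] down_weight_pos[of c]
      by (simp add: zweight_def)
  next
    case 3
    then show ?thesis using up(1) down_weight_neg[of b] down_weight_neg[of c]
      by (simp add: zweight_def)
  qed
next
  assume down: "a \<noteq> 0" "b = a - sgn a" "\<eta> = down_weight a - down_weight b"
  show ?thesis
  proof (cases "\<bar>a\<bar> = \<bar>c\<bar>")
    case True
    then have "c = - a" "b = sgn c - c"
      using down assms(2) by (auto simp: zdist_def sgn_if split: if_splits)
    then show ?thesis using down by (auto simp: zweight_def sgn_if add.commute)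
  next
    case False
    then show ?thesis using down assms(2)
      by (auto simp: zweight_def zdist_def sgn_if split: if_splits)
  qed
qed

section \<open>Paths of the graph compared with the closed formulas\<close>

lemma qbg_path_Cons:
  "qbg_path u (e # p) v \<longleftrightarrow> u \<in> weyl \<and> e \<in> arcs QBG \<and> tail QBG e = u \<and> qbg_path (head QBG e) p v"
proof -
  have "head QBG e \<in> weyl" if "e \<in> arcs QBG"
    using that by (auto simp: arcs_QBG weyl_eq_range) (simp add: QBG_def)
  then show ?thesis by (auto simp: pre_digraph.awalk_def pre_digraph.cas.simps QBG_def)
qed

text \<open>Each arc lowers \<open>zdist\<close> by at most one; on a path of length
  \<open>zdist a c\<close> every arc lowers it by exactly one, which is when
  \<open>zweight_step\<close> applies.\<close>

lemma qbg_path_zdist: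
  assumes "qbg_path (weyl_elt a) p (weyl_elt c)"
  shows "zdist a c \<le> int (length p) \<and> (zdist a c = int (length p) \<longrightarrow> path_weight p = zweight a c)"
  using assms
proof (induction p arbitrary: a)
  case Nil
  then have "a = c" by (simp add: pre_digraph.awalk_def pre_digraph.cas.simps inj_weyl_elt)
  then show ?case by (auto simp: zdist_def zweight_def path_weight_def)
next
  case (Cons e p)
  have e: "e \<in> arcs QBG" "tail QBG e = weyl_elt a" "qbg_path (head QBG e) p (weyl_elt c)"
    using Cons.prems by (simp_all add: qbg_path_Cons)
  obtain a' \<eta> b where b': "e = (weyl_elt a', \<eta>, weyl_elt b)" "step a' \<eta> b"
    using e(1) unfolding arcs_QBG by blast
  have "a' = a" using e(2) b'(1) by (simp add: QBG_def inj_weyl_elt)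
  note b = b'[unfolded this]
  have "head QBG e = weyl_elt b" using b by (simp add: QBG_def)
  then have IH: "zdist b c \<le> int (length p)"
    "zdist b c = int (length p) \<Longrightarrow> path_weight p = zweight b c"
    using Cons.IH e(3) by auto
  have w: "path_weight (e # p) = \<eta> + path_weight p" using b by (simp add: path_weight_def)
  note t = zdist_step[OF b(2), of c] zweight_step[OF b(2), of c]
  show ?case
  proof (intro conjI impI)
    show "zdist a c \<le> int (length (e # p))" using t(1) IH(1) by simp
    assume "zdist a c = int (length (e # p))"
    then have "zdist b c = int (length p)" "zdist a c = 1 + zdist b c" using t(1) IH(1) by auto
    then show "path_weight (e # p) = zweight a c" using t(2) IH(2) w by simp
  qed
qed

lemma ex_qbg_path:
  assumes "zdist a c = int n"
  shows "\<exists>p. qbg_path (weyl_elt a) p (weyl_elt c) \<and> length p = n"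
  using assms
proof (induction n arbitrary: a)
  case 0
  then have "a = c" by (auto simp: zdist_def split: if_splits)
  then show ?case
    by (intro exI[of _ "[]"])
      (auto simp: pre_digraph.awalk_def pre_digraph.cas.simps QBG_def weyl_eq_range)
next
  case (Suc n)
  have "\<exists>\<eta> b. step a \<eta> b \<and> zdist b c = int n"
  proof (cases "\<bar>a\<bar> < \<bar>c\<bar>")
    case True
    define b where "b = (if c > 0 then \<bar>a\<bar> + 1 else - \<bar>a\<bar> - 1)"
    have "step a 0 b" "zdist b c = int n"
      using True Suc.prems by (auto simp: b_def step_def zdist_def split: if_splits)
    then show ?thesis by blast
  next
    case False
    \<comment> \<open>Descending is optimal even if the side must change, since the crossing can
      wait until the element is shorter than \<open>c\<close>.\<close>
    define b where "b = a - sgn a"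
    have "a \<noteq> 0" using False Suc.prems by (auto simp: zdist_def)
    then have "step a (down_weight a - down_weight b) b" by (simp add: b_def step_def)
    moreover have "zdist b c = int n"
      using False Suc.prems \<open>a \<noteq> 0\<close> by (auto simp: b_def zdist_def sgn_if split: if_splits)
    ultimately show ?thesis by blast
  qed
  then obtain \<eta> b where b: "step a \<eta> b" "zdist b c = int n" by blast
  then obtain p where p: "qbg_path (weyl_elt b) p (weyl_elt c)" "length p = n"
    using Suc.IH by blast
  define e where "e = (weyl_elt a, \<eta>, weyl_elt b)"
  have "e \<in> arcs QBG" using b(1) unfolding arcs_QBG e_def by blast
  moreover have "tail QBG e = weyl_elt a" "head QBG e = weyl_elt b" by (simp_all add: e_def QBG_def)
  ultimately have "qbg_path (weyl_elt a) (e # p) (weyl_elt c)"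
    using p by (simp add: qbg_path_Cons weyl_eq_range)
  then show ?case using p(2) by (intro exI[of _ "e # p"]) simp
qed

lemma qbg_dist_elt: "qbg_dist (weyl_elt a) (weyl_elt c) = enat (nat (zdist a c))"
proof -
  have nn: "zdist a c \<ge> 0" by (simp add: zdist_def)
  then obtain p where p: "qbg_path (weyl_elt a) p (weyl_elt c)" "length p = nat (zdist a c)"
    using ex_qbg_path[of a c "nat (zdist a c)"] by auto
  show ?thesis unfolding qbg_dist_def
  proof (rule antisym)
    show "(INF p\<in>{p. qbg_path (weyl_elt a) p (weyl_elt c)}. enat (length p)) \<le> enat (nat (zdist a c))"
      by (rule INF_lower2[of p]) (use p in auto)
    show "enat (nat (zdist a c)) \<le> (INF p\<in>{p. qbg_path (weyl_elt a) p (weyl_elt c)}. enat (length p))"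
      by (rule INF_greatest) (use qbg_path_zdist in force)
  qed
qed

lemma shortest_qbg_path_weight:
  assumes "shortest_qbg_path (weyl_elt a) p (weyl_elt c)"
  shows "path_weight p = zweight a c"
proof -
  have "zdist a c \<ge> 0" by (simp add: zdist_def)
  then show ?thesis using assms qbg_path_zdist[of a p c]
    by (auto simp: shortest_qbg_path_def qbg_dist_elt)
qed


section \<open>Length positive elements\<close>

text \<open>\<open>LP_fun M k l n\<close> is \<open>\<ell>(x, \<alpha> + n\<delta>)\<close> for \<open>x = w \<epsilon>\<^sup>\<mu>\<close> with \<open>\<mu> = k\<alpha>\<^sup>\<or> + m\<delta> + l\<Lambda>\<^sub>0\<close> and
  \<open>w\<^sup>-\<^sup>1 = weyl_elt M\<close>.\<close>

definition LP_fun :: "int \<Rightarrow> int \<Rightarrow> int \<Rightarrow> int \<Rightarrow> int" where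
  "LP_fun M k l n = 2 * k + n * l + (if n \<ge> 0 then 1 else 0) - (if n \<ge> M then 1 else 0)"

text \<open>The numbers of the length positive elements. The length functional is odd in the root,
  so conditions at -\<alpha> + n\<delta> become upper bounds at \<alpha> - n\<delta>.\<close>

definition LP_set :: "int \<Rightarrow> int \<Rightarrow> int \<Rightarrow> int set" where
  "LP_set M k l = {a. (\<forall>n\<ge>a. LP_fun M k l n \<ge> 0) \<and> (\<forall>n<a. LP_fun M k l n \<le> 0)}"

lemma root_act_elt:
  "root_act (weyl_elt a) (1, n) = (if even a then (1, n + a) else (- 1, n - a + 1))"
  "root_act (weyl_elt a) (- 1, n) = (if even a then (- 1, n - a) else (1, n + a - 1))"
  by (cases "even a"; auto elim!: evenE oddE
      simp: weyl_elt_even weyl_elt_odd root_act_normal_form roots_def)+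

lemma length_fun_elt:
  assumes "M = (if even w then - w else w)"
  shows "length_fun (weyl_elt w, (k, m, l)) (1, n) = LP_fun M k l n"
    and "length_fun (weyl_elt w, (k, m, l)) (- 1, n) = - LP_fun M k l (- n)"
  using assms by (auto simp: LP_fun_def root_act_elt pos_ind_def pos_roots_def)

lemma ball_pos_roots: "(\<forall>\<beta>\<in>pos_roots. P \<beta>) \<longleftrightarrow> (\<forall>n\<ge>0. P (1, n)) \<and> (\<forall>n\<ge>1. P (- 1, n))"
  by (auto simp: pos_roots_def)

lemma weyl_elt_mem_LP:
  assumes "M = (if even w then - w else w)"
  shows "weyl_elt a \<in> LP (weyl_elt w, (k, m, l)) \<longleftrightarrow> a \<in> LP_set M k l"
proof -
  let ?f = "LP_fun M k l"
  have "weyl_elt a \<in> LP (weyl_elt w, (k, m, l)) \<longleftrightarrow>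
      (if even a then (\<forall>n\<ge>0. ?f (n + a) \<ge> 0) \<and> (\<forall>n\<ge>1. - ?f (- (n - a)) \<ge> 0)
       else (\<forall>n\<ge>0. - ?f (- (n - a + 1)) \<ge> 0) \<and> (\<forall>n\<ge>1. ?f (n + a - 1) \<ge> 0))"
    by (cases "even a") (simp_all only: LP_def ball_pos_roots root_act_elt if_True if_False
        length_fun_elt[OF assms] mem_Collect_eq weyl_eq_range rangeI simp_thms)
  moreover have "(\<forall>n\<ge>0. ?f (n + a) \<ge> 0) \<longleftrightarrow> (\<forall>n\<ge>a. ?f n \<ge> 0)"
    by (metis add.commute add_le_cancel_left diff_add_cancel diff_ge_0_iff_ge le_add_same_cancel2)
  moreover have "(\<forall>n\<ge>1. - ?f (- (n - a)) \<ge> 0) \<longleftrightarrow> (\<forall>n<a. ?f n \<le> 0)"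
  proof (intro iffI allI impI)
    fix n assume "\<forall>n\<ge>1. - ?f (- (n - a)) \<ge> 0" "n < a"
    then show "?f n \<le> 0" by (auto dest!: spec[of _ "a - n"])
  qed auto
  moreover have "(\<forall>n\<ge>0. - ?f (- (n - a + 1)) \<ge> 0) \<longleftrightarrow> (\<forall>n<a. ?f n \<le> 0)"
  proof (intro iffI allI impI)
    fix n assume "\<forall>n\<ge>0. - ?f (- (n - a + 1)) \<ge> 0" "n < a"
    then show "?f n \<le> 0" by (auto dest!: spec[of _ "a - n - 1"])
  qed auto
  moreover have "(\<forall>n\<ge>1. ?f (n + a - 1) \<ge> 0) \<longleftrightarrow> (\<forall>n\<ge>a. ?f n \<ge> 0)"
  proof (intro iffI allI impI)
    fix n assume "\<forall>n\<ge>1. ?f (n + a - 1) \<ge> 0" "n \<ge> a"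
    then show "?f n \<ge> 0" by (auto dest!: spec[of _ "n - a + 1"])
  qed auto
  ultimately show ?thesis unfolding LP_set_def by auto
qed

section \<open>Length positive elements form intervals with restricted positions\<close>

lemma LP_set_convex: "a \<in> LP_set M k l \<Longrightarrow> b \<in> LP_set M k l \<Longrightarrow> {a..b} \<subseteq> LP_set M k l"
  by (auto simp: LP_set_def)

lemma LP_fun_eq_0:
  assumes "a \<in> LP_set M k l" "b \<in> LP_set M k l" "a \<le> n" "n < b"
  shows "LP_fun M k l n = 0"
  using assms by (force simp: LP_set_def)

lemma LP_set_two_sided:
  assumes "- 1 \<in> LP_set M k l" "1 \<in> LP_set M k l" "l \<ge> 0"
  shows "LP_set M k l = UNIV"
proof -
  have "LP_fun M k l (- 1) = 0" "LP_fun M k l 0 = 0"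
    using assms LP_fun_eq_0 by fastforce+
  \<comment> \<open>The value at 0 gives \<open>k = 0\<close> by parity, and
    \<open>M \<le> 0\<close>; the value at -1 and \<open>l \<ge> 0\<close> give the rest.\<close>
  then have "k = 0 \<and> l = 0 \<and> M = 0" using assms(3) by (auto simp: LP_fun_def split: if_splits)
  then show ?thesis by (auto simp: LP_set_def LP_fun_def)
qed

lemma LP_set_next:
  assumes "M \<in> LP_set M k l" "M + 2 \<in> LP_set M k l \<or> M - 2 \<in> LP_set M k l" "l \<ge> 0" "l = 0 \<longrightarrow> k = 0"
  shows "LP_set M k l = UNIV"
proof -
  \<comment> \<open>Neither pair of neighbours straddles the jump at \<open>M\<close>, so its values
    differ by \<open>l\<close> plus 0 or 1, which forces \<open>l = 0\<close>.\<close>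
  have "LP_fun M k l M = 0 \<and> LP_fun M k l (M + 1) = 0 \<or>
      LP_fun M k l (M - 1) = 0 \<and> LP_fun M k l (M - 2) = 0"
    using assms(1,2) LP_fun_eq_0 by fastforce
  then have l: "l = 0" using assms(3) by (auto simp: LP_fun_def algebra_simps split: if_splits)
  then have "\<forall>n\<ge>M. LP_fun M 0 0 n \<ge> 0" "\<forall>n<M. LP_fun M 0 0 n \<le> 0"
    using assms(1,4) by (auto simp: LP_set_def)
  then have "LP_fun M 0 0 M \<ge> 0" "M > 0 \<longrightarrow> LP_fun M 0 0 0 \<le> 0" by auto
  then have "M = 0" by (auto simp: LP_fun_def split: if_splits)
  then show ?thesis using l assms(4) by (auto simp: LP_set_def LP_fun_def)
qed


section \<open>Minimising pairs\<close>

lemma zdist_same_side: "a \<le> c \<Longrightarrow> 0 \<le> a \<or> c \<le> 0 \<Longrightarrow> zdist a c = c - a"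
  by (auto simp: zdist_def)

lemma zdist_opposite: "a \<le> 0 \<Longrightarrow> 0 < c \<Longrightarrow> zdist a c = (if a + c > 0 then a + c else 2 - a - c)"
  by (auto simp: zdist_def)

text \<open>On one side of 0 the distance is \<open>c - a\<close>, so the innermost pair is the only
  minimiser. Across 0 it depends on \<open>a + c\<close> alone and is least at sum 1; if 1 is not
  attained, convexity leaves one minimiser.\<close>

lemma minimisers_below:
  fixes I J :: "int set"
  assumes convI: "\<And>a b. a \<in> I \<Longrightarrow> b \<in> I \<Longrightarrow> {a..b} \<subseteq> I"
    and convJ: "\<And>a b. a \<in> J \<Longrightarrow> b \<in> J \<Longrightarrow> {a..b} \<subseteq> J"
    and I: "- 1 \<notin> I \<or> 1 \<notin> I"
    and J: "0 \<notin> J \<or> 2 \<notin> J"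
    and below: "\<And>a c. a \<in> I \<Longrightarrow> c \<in> J \<Longrightarrow> a < c"
    and mem: "a \<in> I" "c \<in> J" "a' \<in> I" "c' \<in> J"
    and min: "\<And>x y. x \<in> I \<Longrightarrow> y \<in> J \<Longrightarrow> zdist a c \<le> zdist x y"
    and eq: "zdist a' c' = zdist a c"
  shows "a = a' \<and> c = c' \<or> a + c = 1 \<and> a' + c' = 1 \<and> a \<le> 0 \<and> a' \<le> 0"
proof -
  have min': "zdist a' c' \<le> zdist x y" if "x \<in> I" "y \<in> J" for x y
    using min eq that by simp
  note b = below[OF mem(1,2)] below[OF mem(3,4)] below[OF mem(1,4)] below[OF mem(3,2)]
  have cI: "x \<in> I" if "a \<le> x \<and> x \<le> a' \<or> a' \<le> x \<and> x \<le> a" for x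
    using convI mem that by fastforce
  have cJ: "x \<in> J" if "c \<le> x \<and> x \<le> c' \<or> c' \<le> x \<and> x \<le> c" for x
    using convJ mem that by fastforce
  show ?thesis
  proof (cases "\<exists>x\<in>I. x > 0")
    case True
    then obtain x0 where x0: "x0 \<in> I" "x0 > 0" by blast
    have nonneg: "x \<ge> 0" if "x \<in> I" for x
    proof (rule ccontr)
      assume "\<not> x \<ge> 0"
      then have "- 1 \<in> {x..x0}" "1 \<in> {x..x0}" using x0(2) by auto
      then show False using convI[OF that x0(1)] I by blast
    qed
    have "zdist a c \<le> zdist (max a a') (min c c')"
      using min mem by (simp add: max_def min_def)
    moreover have "zdist a c = c - a" "zdist a' c' = c' - a'"
      "zdist (max a a') (min c c') = min c c' - max a a'"
      using nonneg[OF mem(1)] nonneg[OF mem(3)] b by (auto intro!: zdist_same_side)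
    ultimately show ?thesis using eq by linarith
  next
    case False
    then have np: "a \<le> 0" "a' \<le> 0" using mem by force+
    consider "c \<le> 0 \<and> c' \<le> 0" | "c \<le> 0 \<and> c' > 0 \<or> c' \<le> 0 \<and> c > 0" | "c > 0 \<and> c' > 0" by linarith
    then show ?thesis
    proof cases
      case 1
      have "zdist a c \<le> zdist (max a a') (min c c')"
        using min mem by (simp add: max_def min_def)
      moreover have "zdist a c = c - a" "zdist a' c' = c' - a'"
        "zdist (max a a') (min c c') = min c c' - max a a'"
        using 1 b by (auto intro!: zdist_same_side)
      ultimately show ?thesis using eq by linarith
    next
      case 2
      \<comment> \<open>The positive one of \<open>c\<close> and \<open>c'\<close> must be 1, but
        the target 0 is one step closer.\<close>
      have "0 \<in> J" using 2 by (intro cJ) auto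
      then have "2 \<notin> J" using J by blast
      then have "c < 2" "c' < 2" using convJ[OF \<open>0 \<in> J\<close> mem(2)] convJ[OF \<open>0 \<in> J\<close> mem(4)]
        by (meson atLeastAtMost_iff not_le subsetD zero_le_numeral)+
      then have "c = 1 \<or> c' = 1" using 2 by linarith
      moreover have neg: "a < 0" "a' < 0" using below \<open>0 \<in> J\<close> mem by blast+
      moreover have "zdist a 0 = - a" "zdist a' 0 = - a'" using neg by (simp_all add: zdist_same_side)
      moreover have "zdist a 1 = 1 - a" "zdist a' 1 = 1 - a'" using neg by (simp_all add: zdist_opposite)
      ultimately have False
        using min[OF mem(1) \<open>0 \<in> J\<close>] min'[OF mem(3) \<open>0 \<in> J\<close>] by auto
      then show ?thesis ..
    next
      case 3
      have D: "zdist a c = (if a + c > 0 then a + c else 2 - a - c)"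
        "zdist a' c' = (if a' + c' > 0 then a' + c' else 2 - a' - c')"
        using np 3 by (simp_all add: zdist_opposite)
      have near: "a + c = 1 \<and> a' + c' = 1" if "x \<in> I" "y \<in> J" "x \<le> 0" "y > 0" "x + y = 1" for x y
      proof -
        have "zdist a c \<le> 1" "zdist a' c' \<le> 1"
          using min[OF that(1,2)] min'[OF that(1,2)] that(3-5) by (simp_all add: zdist_opposite)
        then show ?thesis unfolding D by (auto split: if_splits)
      qed
      show ?thesis
      proof (rule ccontr)
        assume n: "\<not> ?thesis"
        have far: "x + y \<noteq> 1" if "x \<in> I" "y \<in> J" "x \<le> 0" "y > 0" for x y
          using near[OF that] n np by blast
        have pos: "c > 0" "c' > 0" using 3 by simp_all
        have ends: "a + c \<noteq> 1" "a' + c' \<noteq> 1"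
          using far[OF mem(1,2) np(1) pos(1)] far[OF mem(3,4) np(2) pos(2)] by simp_all
        consider "a + c > 1" "a' + c' > 1" | "a + c < 1" "a' + c' < 1"
          | "a + c > 1" "a' + c' < 1" | "a + c < 1" "a' + c' > 1" using ends by linarith
        then show False
        proof cases
          case 1
          \<comment> \<open>Of two distinct pairs with equal sum, the one with larger
            \<open>a\<close> can be lowered within \<open>I\<close>, bringing the sum closer to
            1.\<close>
          then have "a + c = a' + c'" using eq unfolding D by simp
          then have "a \<noteq> a'" using n by auto
          then consider "a < a'" | "a' < a" by linarith
          then show False
          proof cases
            case 1
            then have "zdist a' c' \<le> zdist (a' - 1) c'" by (intro min' cI mem) auto
            moreover have "zdist (a' - 1) c' = a' - 1 + c'" "zdist a' c' = a' + c'"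
              using np pos \<open>a' + c' > 1\<close> by (simp_all add: zdist_opposite)
            ultimately show False by simp
          next
            case 2
            then have "zdist a c \<le> zdist (a - 1) c" by (intro min cI mem) auto
            moreover have "zdist (a - 1) c = a - 1 + c" "zdist a c = a + c"
              using np pos \<open>a + c > 1\<close> by (simp_all add: zdist_opposite)
            ultimately show False by simp
          qed
        next
          case 2
          then have "a + c = a' + c'" using eq unfolding D by simp
          then have "a \<noteq> a'" using n by auto
          then consider "a < a'" | "a' < a" by linarith
          then show False
          proof cases
            case 1
            then have "zdist a c \<le> zdist (a + 1) c" by (intro min cI mem) auto
            moreover have "zdist (a + 1) c \<le> 1 - a - c" "zdist a c = 2 - a - c"
              using np pos \<open>a + c < 1\<close> 1 by (simp_all add: zdist_opposite)
            ultimately show False by simp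
          next
            case 2
            then have "zdist a' c' \<le> zdist (a' + 1) c'" by (intro min' cI mem) auto
            moreover have "zdist (a' + 1) c' \<le> 1 - a' - c'" "zdist a' c' = 2 - a' - c'"
              using np pos \<open>a' + c' < 1\<close> 2 by (simp_all add: zdist_opposite)
            ultimately show False by simp
          qed
        next
          case 3
          \<comment> \<open>The sums lie on both sides of 1; passing through the mixed pair
            \<open>a\<close>, \<open>c'\<close> and changing one entry at a time, convexity yields a
            pair with sum 1.\<close>
          show False
          proof (cases "a + c' \<ge> 1")
            case True
            then have "1 - c' \<in> I" using \<open>a' + c' < 1\<close> by (intro cI) auto
            then show False using far[of "1 - c'" c'] mem pos by simp
          next
            case False
            then have "1 - a \<in> J" using \<open>a + c > 1\<close> by (intro cJ) auto
            then show False using far[of a "1 - a"] mem np by simp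
          qed
        next
          case 4
          show False
          proof (cases "a' + c \<ge> 1")
            case True
            then have "1 - c \<in> I" using \<open>a + c < 1\<close> by (intro cI) auto
            then show False using far[of "1 - c" c] mem pos by simp
          next
            case False
            then have "1 - a' \<in> J" using \<open>a' + c' > 1\<close> by (intro cJ) auto
            then show False using far[of a' "1 - a'"] mem np by simp
          qed
        qed
      qed
    qed
  qed
qed

text \<open>Overlapping intervals give distance 0. Disjoint ones are ordered, which reduces to
  \<open>minimisers_below\<close>; pairs of sum 1 or -1 there are single rises, hence of weight
  0.\<close>

lemma minimisers:
  fixes I J :: "int set"
  assumes convI: "\<And>a b. a \<in> I \<Longrightarrow> b \<in> I \<Longrightarrow> {a..b} \<subseteq> I"
    and convJ: "\<And>a b. a \<in> J \<Longrightarrow> b \<in> J \<Longrightarrow> {a..b} \<subseteq> J"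
    and I: "- 1 \<in> I \<Longrightarrow> 1 \<in> I \<Longrightarrow> I = UNIV"
    and J: "0 \<in> J \<Longrightarrow> 2 \<in> J \<or> - 2 \<in> J \<Longrightarrow> J = UNIV"
    and mem: "a \<in> I" "c \<in> J" "a' \<in> I" "c' \<in> J"
    and min: "\<And>x y. x \<in> I \<Longrightarrow> y \<in> J \<Longrightarrow> zdist a c \<le> zdist x y"
    and eq: "zdist a' c' = zdist a c"
  shows "a = a' \<and> c = c' \<or> a = c \<and> a' = c' \<or>
    (\<exists>s\<in>{1, - 1}. a + c = s \<and> a' + c' = s) \<and> zweight a c = 0 \<and> zweight a' c' = 0"
proof (cases "I \<inter> J = {}")
  case False
  then obtain z where "z \<in> I" "z \<in> J" by blast
  then have "zdist a c \<le> 0" "zdist a' c' \<le> 0" using min[of z z] eq zdist_le_0[of z z] by auto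
  then show ?thesis by (simp add: zdist_le_0)
next
  case True
  then have "I \<noteq> UNIV" "J \<noteq> UNIV" using mem by auto
  then have I': "- 1 \<notin> I \<or> 1 \<notin> I" and J': "0 \<notin> J \<or> 2 \<notin> J" "0 \<notin> J \<or> - 2 \<notin> J"
    using I J by blast+
  have side: "x < y \<longleftrightarrow> a < c" if "x \<in> I" "y \<in> J" for x y
  proof (rule ccontr)
    assume "(x < y) \<noteq> (a < c)"
    then consider "x < y" "c \<le> a" | "y \<le> x" "a < c" by linarith
    then show False
    proof cases
      case 1
      have "c \<in> I" if "x \<le> c" using that 1 convI[OF \<open>x \<in> I\<close> mem(1)] by auto
      moreover have "x \<in> J" if "c \<le> x" using that 1 convJ[OF mem(2) \<open>y \<in> J\<close>] by auto
      ultimately show False using True that mem by (meson disjoint_iff linear)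
    next
      case 2
      have "y \<in> I" if "a \<le> y" using that 2 convI[OF mem(1) \<open>x \<in> I\<close>] by auto
      moreover have "a \<in> J" if "y \<le> a" using that 2 convJ[OF \<open>y \<in> J\<close> mem(2)] by auto
      ultimately show False using True that mem by (meson disjoint_iff linear)
    qed
  qed
  show ?thesis
  proof (cases "a < c")
    case less: True
    have below: "x < y" if "x \<in> I" "y \<in> J" for x y using side[OF that] less by blast
    have "a = a' \<and> c = c' \<or> a + c = 1 \<and> a' + c' = 1 \<and> a \<le> 0 \<and> a' \<le> 0"
      by (rule minimisers_below[OF convI convJ I' J'(1) below mem min eq])
    then show ?thesis by (auto intro!: zweight_up)
  next
    case greater: False
    \<comment> \<open>This symmetry exchanges \<open>s0\<close> and \<open>s1\<close> and turns the
      condition on \<open>- 2\<close> into the one on \<open>2\<close>.\<close>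
    have neg: "zdist (- x) (- y) = zdist x y" for x y by (simp add: zdist_def disj_commute conj_commute)
    have mem': "x \<in> uminus ` A \<longleftrightarrow> - x \<in> A" for x :: int and A
      by (metis (no_types) image_iff minus_minus)
    have "- a = - a' \<and> - c = - c' \<or> - a + - c = 1 \<and> - a' + - c' = 1 \<and> - a \<le> 0 \<and> - a' \<le> 0"
    proof (rule minimisers_below[of "uminus ` I" "uminus ` J"])
      show "{x..y} \<subseteq> uminus ` I" if "x \<in> uminus ` I" "y \<in> uminus ` I" for x y
        using convI[of "- y" "- x"] that unfolding mem' by (auto simp: mem' subset_eq)
      show "{x..y} \<subseteq> uminus ` J" if "x \<in> uminus ` J" "y \<in> uminus ` J" for x y
        using convJ[of "- y" "- x"] that unfolding mem' by (auto simp: mem' subset_eq)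
      show "- 1 \<notin> uminus ` I \<or> 1 \<notin> uminus ` I" using I' by (auto simp: mem')
      show "0 \<notin> uminus ` J \<or> 2 \<notin> uminus ` J" using J'(2) by (auto simp: mem')
      show "x < y" if "x \<in> uminus ` I" "y \<in> uminus ` J" for x y
      proof -
        have m: "- x \<in> I" "- y \<in> J" using that unfolding mem' .
        have "- x \<noteq> - y" using m True by auto
        moreover have "\<not> - x < - y" using side[OF m] greater by blast
        ultimately show ?thesis by simp
      qed
      show "zdist (- a) (- c) \<le> zdist x y" if "x \<in> uminus ` I" "y \<in> uminus ` J" for x y
        using min[of "- x" "- y"] that unfolding mem' neg by simp
      show "zdist (- a') (- c') = zdist (- a) (- c)" by (simp add: neg eq)
    qed (use mem in auto)
    then show ?thesis by (auto intro!: zweight_up)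
  qed
qed


section \<open>Independence of the choices\<close>

theorem theorem4p7:
  fixes x y :: daw
    and u v u' v' :: "coweight \<Rightarrow> coweight"
    and p p' :: "qbg_arc list"
  assumes "x \<in> daw_semigroup" and "y \<in> daw_semigroup"
    and "(u, v) \<in> min_pairs x y" and "shortest_qbg_path u p (fst y \<circ> v)"
    and "(u', v') \<in> min_pairs x y" and "shortest_qbg_path u' p' (fst y \<circ> v')"
  shows "demazure_prod x y u v p = demazure_prod x y u' v' p'"
proof -
  obtain wx kx mx lx where x: "x = (weyl_elt wx, (kx, mx, lx))" "lx \<ge> 0" "lx = 0 \<longrightarrow> kx = 0"
    using assms(1) by (auto simp: daw_semigroup_def weyl_eq_range tits_cone_def)
  obtain wy ky my ly where y: "y = (weyl_elt wy, (ky, my, ly))" "ly \<ge> 0" "ly = 0 \<longrightarrow> ky = 0"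
    using assms(2) by (auto simp: daw_semigroup_def weyl_eq_range tits_cone_def)
  define Mx where "Mx = (if even wx then - wx else wx)"
  define My where "My = (if even wy then - wy else wy)"
  define t where "t = (\<lambda>b. if even wy then wy + b else wy - b)"
  define I where "I = LP_set Mx kx lx"
  define L where "L = LP_set My ky ly"
  define t' where "t' = (\<lambda>c. if even wy then c - wy else wy - c)"
  have tt: "t (t' c) = c" "t' (t c) = c" for c by (simp_all add: t_def t'_def)
  have t_mult: "weyl_elt wy \<circ> weyl_elt b = weyl_elt (t b)" for b by (simp add: weyl_elt_mult t_def)
  \<comment> \<open>\<open>J\<close> consists of the numbers of the endpoints w_y v, so the
    distances to minimise run from \<open>I\<close> to \<open>J\<close>.\<close>
  define J where "J = {c. t' c \<in> L}"
  have LPx: "weyl_elt a \<in> LP x \<longleftrightarrow> a \<in> I" for a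
    unfolding x(1) I_def by (rule weyl_elt_mem_LP) (simp add: Mx_def)
  have LPy: "weyl_elt b \<in> LP y \<longleftrightarrow> b \<in> L" for b
    unfolding y(1) L_def by (rule weyl_elt_mem_LP) (simp add: My_def)
  have convJ: "{c..c'} \<subseteq> J" if "c \<in> J" "c' \<in> J" for c c'
  proof -
    have "{t' c..t' c'} \<subseteq> L" "{t' c'..t' c} \<subseteq> L"
      using that LP_set_convex unfolding J_def L_def by auto
    then show ?thesis unfolding J_def t'_def by (auto split: if_splits)
  qed
  have J0: "J = UNIV" if "0 \<in> J" "2 \<in> J \<or> - 2 \<in> J"
  proof -
    \<comment> \<open>\<open>My\<close> is the number of the inverse of \<open>weyl_elt wy\<close>,
      which is why \<open>LP_set_next\<close> is centred there.\<close>
    have t'0: "t' 0 = My" by (simp add: t'_def My_def)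
    have "t' 2 = My + 2 \<and> t' (- 2) = My - 2 \<or> t' 2 = My - 2 \<and> t' (- 2) = My + 2"
      by (simp add: t'_def My_def)
    then have "My \<in> L" "My + 2 \<in> L \<or> My - 2 \<in> L"
      using that unfolding J_def t'0 mem_Collect_eq by metis+
    then have "L = UNIV" unfolding L_def by (rule LP_set_next) (use y in auto)
    then show ?thesis by (simp add: J_def)
  qed
  have pair: "\<exists>a b. u = weyl_elt a \<and> v = weyl_elt b \<and> a \<in> I \<and> t b \<in> J \<and>
      (\<forall>x\<in>I. \<forall>y\<in>J. zdist a (t b) \<le> zdist x y) \<and>
      path_weight p = zweight a (t b)"
    if min: "(u, v) \<in> min_pairs x y" and path: "shortest_qbg_path u p (fst y \<circ> v)" for u v p
  proof -
    have uv: "u \<in> LP x" "v \<in> LP y"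
      and m: "\<And>u' v'. u' \<in> LP x \<Longrightarrow> v' \<in> LP y \<Longrightarrow> qbg_dist u (fst y \<circ> v) \<le> qbg_dist u' (fst y \<circ> v')"
      using min unfolding min_pairs_def by auto
    have "u \<in> weyl" "v \<in> weyl" using uv by (auto simp: LP_def)
    then obtain a b where ab: "u = weyl_elt a" "v = weyl_elt b" unfolding weyl_eq_range by blast
    have "zdist a (t b) \<le> zdist i j" if "i \<in> I" "j \<in> J" for i j
    proof -
      have "weyl_elt i \<in> LP x" "weyl_elt (t' j) \<in> LP y" using that LPx LPy by (auto simp: J_def)
      from m[OF this] have "nat (zdist a (t b)) \<le> nat (zdist i j)"
        unfolding ab y(1) fst_conv t_mult tt qbg_dist_elt by simp
      moreover have "zdist i j \<ge> 0" by (simp add: zdist_def)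
      ultimately show ?thesis by simp
    qed
    moreover have "a \<in> I" "t b \<in> J" using uv LPx LPy by (auto simp: ab J_def tt)
    moreover have "path_weight p = zweight a (t b)"
      using path unfolding ab y(1) fst_conv t_mult by (rule shortest_qbg_path_weight)
    ultimately show ?thesis using ab by blast
  qed
  obtain a b where ab: "u = weyl_elt a" "v = weyl_elt b" "a \<in> I" "t b \<in> J"
    "\<And>x y. x \<in> I \<Longrightarrow> y \<in> J \<Longrightarrow> zdist a (t b) \<le> zdist x y" "path_weight p = zweight a (t b)"
    using pair[OF assms(3,4)] by blast
  obtain a' b' where ab': "u' = weyl_elt a'" "v' = weyl_elt b'" "a' \<in> I" "t b' \<in> J"
    "\<And>x y. x \<in> I \<Longrightarrow> y \<in> J \<Longrightarrow> zdist a' (t b') \<le> zdist x y" "path_weight p' = zweight a' (t b')"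
    using pair[OF assms(5,6)] by blast
  have eq: "zdist a' (t b') = zdist a (t b)"
    using ab(5)[OF ab'(3,4)] ab'(5)[OF ab(3,4)] by simp
  have "a = a' \<and> t b = t b' \<or> a = t b \<and> a' = t b' \<or>
    (\<exists>s\<in>{1, - 1}. a + t b = s \<and> a' + t b' = s) \<and> zweight a (t b) = 0 \<and> zweight a' (t b') = 0"
  proof (rule minimisers[of I J])
    show "{i..j} \<subseteq> I" if "i \<in> I" "j \<in> I" for i j
      using that unfolding I_def by (rule LP_set_convex)
    show "I = UNIV" if "- 1 \<in> I" "1 \<in> I"
      using that x(2) unfolding I_def by (rule LP_set_two_sided)
  qed (use convJ J0 ab ab' eq in auto)
  \<comment> \<open>Either the pairs agree, or all weights vanish and one \<open>g\<close> takes
    \<open>v\<close> to \<open>u\<close> and \<open>v'\<close> to \<open>u'\<close>: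
    \<open>weyl_elt wy\<close>, possibly multiplied on the left by \<open>s1\<close> or
    \<open>s0\<close>.\<close>
  then consider "a = a'" "b = b'" | g where "weyl_elt a = g \<circ> weyl_elt b" "weyl_elt a' = g \<circ> weyl_elt b'"
    "zweight a (t b) = 0" "zweight a' (t b') = 0"
  proof (elim disjE conjE bexE)
    assume "a = a'" "t b = t b'"
    then show ?thesis using that(1) tt by metis
  next
    assume "a = t b" "a' = t b'"
    then show ?thesis using that(2)[of "weyl_elt wy"] by (simp add: t_mult zweight_self)
  next
    fix s assume s: "s \<in> {1, - 1}" "a + t b = s" "a' + t b' = s"
      and z: "zweight a (t b) = 0" "zweight a' (t b') = 0"
    have "a = s - t b" "a' = s - t b'" using s by auto
    then have "weyl_elt a = weyl_elt s \<circ> weyl_elt (t b)" "weyl_elt a' = weyl_elt s \<circ> weyl_elt (t b')"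
      using s(1) by (auto simp: weyl_elt_mult)
    then show ?thesis using that(2)[of "weyl_elt s \<circ> weyl_elt wy"] z
      by (simp add: comp_assoc t_mult)
  qed
  then show ?thesis
  proof cases
    \<comment> \<open>Only the path can still differ, and its weight is fixed by its
      endpoints.\<close>
    case 1
    then show ?thesis using ab ab' by (simp add: x(1) y(1))
  next
    case 2
    \<comment> \<open>Both components of the product involve the pair only through
      \<open>u \<circ> inv v = g\<close> and \<open>v \<circ> inv u = inv g\<close>.\<close>
    have "weyl_elt c \<circ> inv (weyl_elt d) = g" "weyl_elt d \<circ> inv (weyl_elt c) = inv g"
      if "weyl_elt c = g \<circ> weyl_elt d" for c d
    proof -
      have d: "weyl_elt d \<circ> inv (weyl_elt d) = id" "inv (inv (weyl_elt d)) = weyl_elt d"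
        using bij_weyl_elt[of d] by (simp_all add: surj_iff[symmetric] bij_is_surj inv_inv_eq)
      show g: "weyl_elt c \<circ> inv (weyl_elt d) = g" unfolding that comp_assoc d by simp
      show "weyl_elt d \<circ> inv (weyl_elt c) = inv g"
        unfolding g[symmetric] using bij_weyl_elt d(2) by (simp add: o_inv_distrib bij_imp_bij_inv)
    qed
    note q = this[OF 2(1)] this[OF 2(2)]
    have v: "weyl_elt b (inv (weyl_elt a) \<mu>) = weyl_elt b' (inv (weyl_elt a') \<mu>)" for \<mu>
      using q(2,4) by (metis comp_apply)
    show ?thesis
      using 2(3,4) ab ab' q(1,3) v by (simp add: x(1) y(1) comp_assoc weyl_elt_zero)
  qed
qed

end
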